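(* Let $a<b$ be real numbers, let $r$ be a positive continuous function on $(a,b)$ and let $p$ be a positive integer. Put $R(x,b)=\int_x^b r(t)\,dt$. Then for all measurable functions $f\ge 0$ on $(a,b)$ such that all integrals below exist and are finite, $$\int_a^b r(x)\left(\int_a^x f(t)\,dt\right)^{p+1}dx\le (b-a)^p\int_a^b R(x,b)\,(f(x))^{p+1}\,dx.$$
   Context: Standing assumption: all functions are measurable and all the integrals appearing in the inequality (including those defining $R(x,b)$ and $\int_a^x f$ for $x\in(a,b)$) exist and are finite. *)

theory Defs
  imports "HOL-Analysis.Analysis"
begin

(* The integrals range over open intervals because r and f are only given on the open
   interval (a,b); their values elsewhere, the end points included, are irrelevant. *)

definition R_int :: "(real \<Rightarrow> real) \<Rightarrow> real \<Rightarrow> real \<Rightarrow> real" where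
  "R_int r x b = (LINT t:{x<..<b}|lebesgue. r t)"

end

theory Submission
  imports Defs
begin

(* Jensen's inequality on (a,x) gives (\<integral> f)^(p+1) \<le> (x - a)^p \<integral> f^(p+1). Multiply by r x, bound
   x - a by b - a, integrate over x, and exchange the order of integration over the triangle
   a < t < x < b by Tonelli; the inner integral of r is then R(t,b). *)

text \<open>Convexity: the graph of \<open>s ^ Suc p\<close> lies above its tangent at
  \<open>m\<close>, that is \<open>s ^ Suc p\<close> \<ge>
  \<open>m ^ Suc p + Suc p * m ^ p * (s - m)\<close>. The terms are arranged without subtraction so
  that the inequality can be integrated in \<open>ennreal\<close>. In the induction step, the
  hypothesis is multiplied by \<open>s\<close> and combined with
  \<open>Suc p * m ^ p * (s - m)^2\<close> \<ge> 0.\<close>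

lemma power_tangent_le:
  fixes s m :: real
  assumes "s \<ge> 0" "m \<ge> 0"
  shows "real (Suc p) * m ^ p * s \<le> s ^ Suc p + real p * m ^ Suc p"
proof (induction p)
  case (Suc p)
  have "s * (real (Suc p) * m ^ p * s) \<le> s * (s ^ Suc p + real p * m ^ Suc p)"
    using Suc assms(1) by (rule mult_left_mono)
  moreover have "0 \<le> real (Suc p) * m ^ p * (s - m)\<^sup>2"
    using assms by simp
  ultimately show ?case
    by (simp add: algebra_simps power2_eq_square)
qed simp

text \<open>Jensen's inequality for a power, obtained by integrating over \<open>A\<close> the
  tangent inequality at the mean value of \<open>f\<close>. The right side is a nonnegative
  integral, so it is meaningful even where the power of \<open>f\<close> is not integrable.\<close>

lemma set_integral_power_le_nn_integral:
  fixes f :: "'a \<Rightarrow> real"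
  assumes A: "A \<in> sets M" "emeasure M A \<noteq> \<infinity>"
    and f: "set_integrable M A f" "\<And>t. t \<in> A \<Longrightarrow> f t \<ge> 0"
  shows "ennreal ((LINT t:A|M. f t) ^ Suc p)
    \<le> ennreal (measure M A ^ p) * (\<integral>\<^sup>+t\<in>A. ennreal (f t ^ Suc p) \<partial>M)"
proof -
  define I where "I = (LINT t:A|M. f t)"
  define L where "L = measure M A"
  define J where "J = (\<integral>\<^sup>+t\<in>A. ennreal (f t ^ Suc p) \<partial>M)"
  have [measurable]: "(\<lambda>t. indicator A t * f t) \<in> borel_measurable M"
    using f(1) by (auto simp: set_integrable_def)
  have L: "emeasure M A = ennreal L"
    using A(2) by (simp add: L_def emeasure_eq_ennreal_measure)
  have "0 \<le> I"
    unfolding I_def set_lebesgue_integral_def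
    by (intro Bochner_Integration.integral_nonneg) (auto simp: indicator_def f(2))
  have nnI: "(\<integral>\<^sup>+t. ennreal (indicator A t * f t) \<partial>M) = ennreal I"
    using f unfolding I_def set_lebesgue_integral_def set_integrable_def
    by (subst nn_integral_eq_integral) (auto simp: indicator_def)
  show ?thesis
  proof (cases "L = 0")
    case True
    \<comment> \<open>There is no mean value over a null set, but then the integral of
      \<open>f\<close> is 0, and so is its power, the exponent being positive.\<close>
    then have "A \<in> null_sets M"
      using A L by auto
    then have "AE t in M. t \<notin> A"
      by (rule AE_not_in)
    then have "I = (LINT t|M. 0)"
      unfolding I_def set_lebesgue_integral_def using f(1)
      by (intro integral_cong_AE) (auto simp: set_integrable_def)
    then show ?thesis
      by (simp flip: I_def)
  next
    case False
    then have "L > 0"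
      by (simp add: L_def order.not_eq_order_implies_strict)
    \<comment> \<open>The tangent point is the mean value of \<open>f\<close> over
      \<open>A\<close>.\<close>
    define m where "m = I / L"
    have "m \<ge> 0"
      using \<open>0 \<le> I\<close> \<open>L > 0\<close> by (simp add: m_def)
    have Lm: "L * m = I"
      using \<open>L > 0\<close> by (simp add: m_def)
    \<comment> \<open>Measurability of \<open>f\<close> is known only after cutting off to
      \<open>A\<close>. Since \<open>0 ^ Suc p = 0\<close>, the power of the cut-off function is the
      cut-off power.\<close>
    have "(\<lambda>t. (indicator A t * f t) ^ Suc p) \<in> borel_measurable M"
      by measurable
    then have meas: "(\<lambda>t. ennreal (f t ^ Suc p) * indicator A t) \<in> borel_measurable M"
      by (rule measurable_cong[THEN iffD1, rotated, OF measurable_compose[OF _ measurable_ennreal]])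
        (auto simp: indicator_def)
    have "ennreal (real (Suc p) * m ^ p * I)
        = (\<integral>\<^sup>+t. ennreal (real (Suc p) * m ^ p) * ennreal (indicator A t * f t) \<partial>M)"
      using \<open>m \<ge> 0\<close> \<open>0 \<le> I\<close> by (simp add: nn_integral_cmult nnI ennreal_mult del: of_nat_Suc)
    also have "\<dots> \<le> (\<integral>\<^sup>+t. ennreal (f t ^ Suc p) * indicator A t
        + ennreal (real p * m ^ Suc p) * indicator A t \<partial>M)"
      using power_tangent_le[OF f(2) \<open>m \<ge> 0\<close>] \<open>m \<ge> 0\<close> f(2)
      by (intro nn_integral_mono)
        (auto simp: indicator_def simp flip: ennreal_mult ennreal_plus simp del: power_Suc of_nat_Suc
          intro!: ennreal_leI)
    also have "\<dots> = J + ennreal (real p * m ^ Suc p * L)"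
      using A meas \<open>m \<ge> 0\<close> \<open>L > 0\<close> unfolding J_def
      by (subst nn_integral_add)
        (auto simp: nn_integral_cmult_indicator L simp flip: ennreal_mult simp del: power_Suc)
    also have "real p * m ^ Suc p * L = real p * m ^ p * I"
      by (simp flip: Lm)
    \<comment> \<open>Of the \<open>Suc p\<close> copies of \<open>m ^ p * I\<close> on the left,
      \<open>p\<close> cancel against the constant term of the tangent; cancelling in
      \<open>ennreal\<close> is sound because this term is finite. Multiplying by
      \<open>L ^ p\<close> then turns \<open>m ^ p * I\<close> into \<open>I ^ Suc p\<close>, as
      \<open>L * m = I\<close>.\<close>
    finally have "ennreal (m ^ p * I) + ennreal (real p * m ^ p * I)
        \<le> J + ennreal (real p * m ^ p * I)"
      using \<open>m \<ge> 0\<close> \<open>0 \<le> I\<close> by (simp add: algebra_simps flip: ennreal_plus)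
    then have "ennreal (m ^ p * I) \<le> J"
      by (simp add: ennreal_add_left_cancel_le add.commute)
    then have "ennreal (L ^ p) * ennreal (m ^ p * I) \<le> ennreal (L ^ p) * J"
      by (rule mult_left_mono) simp
    also have "ennreal (L ^ p) * ennreal (m ^ p * I) = ennreal (I ^ Suc p)"
      using \<open>m \<ge> 0\<close> \<open>0 \<le> I\<close> \<open>L > 0\<close>
      by (simp flip: ennreal_mult Lm add: power_mult_distrib mult_ac)
    finally show ?thesis
      by (simp only: I_def L_def J_def)
  qed
qed

text \<open>Makes Tonelli available for \<open>lebesgue\<close>, the completion of
  \<open>lborel\<close>. Completion keeps the measure of the sets of \<open>M\<close>, so a
  countable cover by sets of finite measure stays one.\<close>

lemma sigma_finite_completion:
  assumes "sigma_finite_measure M"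
  shows "sigma_finite_measure (completion M)"
proof
  interpret sigma_finite_measure M by fact
  obtain A where "countable A" "A \<subseteq> sets M" "\<Union>A = space M" "\<forall>a\<in>A. emeasure M a \<noteq> \<infinity>"
    using sigma_finite_countable by blast
  then show "\<exists>A. countable A \<and> A \<subseteq> sets (completion M) \<and> \<Union>A = space (completion M)
      \<and> (\<forall>a\<in>A. emeasure (completion M) a \<noteq> \<infinity>)"
    by (intro exI[of _ A]) (auto simp: subset_eq)
qed

interpretation lebesgue: sigma_finite_measure "lebesgue :: 'a::euclidean_space measure"
  by (rule sigma_finite_completion) (rule sigma_finite_lborel)

text \<open>Both sides are iterated integrals of one function, \<open>g x * h t\<close> cut off to
  the triangle a < t < x < b, so Tonelli applies.\<close>

lemma nn_integral_triangle_swap: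
  fixes a b :: real and g h :: "real \<Rightarrow> ennreal"
  assumes [measurable]: "g \<in> borel_measurable lebesgue" "h \<in> borel_measurable lebesgue"
  shows "(\<integral>\<^sup>+x\<in>{a<..<b}. g x * (\<integral>\<^sup>+t\<in>{a<..<x}. h t \<partial>lebesgue) \<partial>lebesgue)
    = (\<integral>\<^sup>+t\<in>{a<..<b}. (\<integral>\<^sup>+x\<in>{t<..<b}. g x \<partial>lebesgue) * h t \<partial>lebesgue)"
proof -
  interpret pair_sigma_finite lebesgue "lebesgue :: real measure" ..
  \<comment> \<open>With the identity Borel measurable on \<open>lebesgue\<close>, the comparisons
    that cut out the triangle are measurable on the product.\<close>
  have [measurable]: "(\<lambda>x. x) \<in> borel_measurable lebesgue"
    by (rule measurable_completion) simp
  have [measurable]: "(\<lambda>(x, t). if a < t \<and> t < x \<and> x < b then g x * h t else 0)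
      \<in> borel_measurable (lebesgue \<Otimes>\<^sub>M lebesgue)"
    by measurable
  have "(\<integral>\<^sup>+x\<in>{a<..<b}. g x * (\<integral>\<^sup>+t\<in>{a<..<x}. h t \<partial>lebesgue) \<partial>lebesgue)
      = (\<integral>\<^sup>+x. \<integral>\<^sup>+t. (if a < t \<and> t < x \<and> x < b then g x * h t else 0) \<partial>lebesgue \<partial>lebesgue)"
    by (intro nn_integral_cong)
      (simp flip: nn_integral_cmult nn_integral_multc,
        intro nn_integral_cong, auto simp: indicator_def)
  also have "\<dots> = (\<integral>\<^sup>+t. \<integral>\<^sup>+x. (if a < t \<and> t < x \<and> x < b then g x * h t else 0) \<partial>lebesgue \<partial>lebesgue)"
    by (rule Fubini'[symmetric]) measurable
  also have "\<dots> = (\<integral>\<^sup>+t\<in>{a<..<b}. (\<integral>\<^sup>+x\<in>{t<..<b}. g x \<partial>lebesgue) * h t \<partial>lebesgue)"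
    by (intro nn_integral_cong)
      (simp flip: nn_integral_multc, intro nn_integral_cong, auto simp: indicator_def)
  finally show ?thesis .
qed

lemma ennreal_set_integral:
  fixes f :: "'a \<Rightarrow> real"
  assumes "set_integrable M A f" "\<And>x. x \<in> A \<Longrightarrow> f x \<ge> 0"
  shows "ennreal (LINT x:A|M. f x) = (\<integral>\<^sup>+x\<in>A. ennreal (f x) \<partial>M)"
  using assms unfolding set_lebesgue_integral_def set_integrable_def
  by (subst nn_integral_eq_integral[symmetric])
    (auto simp: indicator_def intro!: nn_integral_cong)

theorem theorem2p18:
  fixes a b :: real and r f :: "real \<Rightarrow> real" and p :: nat
  assumes "a < b"
    and "continuous_on {a<..<b} r"
    and "\<And>x. x \<in> {a<..<b} \<Longrightarrow> r x > 0"
    and "p \<ge> 1"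
    and "set_borel_measurable lebesgue {a<..<b} f"
    and "\<And>x. x \<in> {a<..<b} \<Longrightarrow> f x \<ge> 0"
    and "\<And>x. x \<in> {a<..<b} \<Longrightarrow> set_integrable lebesgue {x<..<b} r"
    and "\<And>x. x \<in> {a<..<b} \<Longrightarrow> set_integrable lebesgue {a<..<x} f"
    and "set_integrable lebesgue {a<..<b}
           (\<lambda>x. r x * (LINT t:{a<..<x}|lebesgue. f t) ^ (p + 1))"
    and "set_integrable lebesgue {a<..<b} (\<lambda>x. R_int r x b * f x ^ (p + 1))"
  shows "(LINT x:{a<..<b}|lebesgue. r x * (LINT t:{a<..<x}|lebesgue. f t) ^ (p + 1))
           \<le> (b - a) ^ p * (LINT x:{a<..<b}|lebesgue. R_int r x b * f x ^ (p + 1))"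
proof -
  note r_pos = assms(3) and f_nonneg = assms(6)
  define F where "F x = (LINT t:{a<..<x}|lebesgue. f t)" for x
  \<comment> \<open>Tonelli needs functions measurable on the whole line, whereas \<open>r\<close>
    and \<open>f\<close> are controlled only on the interval; \<open>g\<close> and \<open>h\<close>
    extend \<open>r\<close> and the power of \<open>f\<close> by zero.\<close>
  define g where "g x = ennreal (indicator {a<..<b} x * r x)" for x
  define h where "h t = ennreal ((indicator {a<..<b} t * f t) ^ Suc p)" for t
  have "(\<lambda>x. indicator {a<..<b} x *\<^sub>R r x) \<in> borel_measurable borel"
    using assms(2) by (intro borel_measurable_continuous_on_indicator) auto
  then have g[measurable]: "g \<in> borel_measurable lebesgue"
    unfolding g_def by (intro measurable_compose[OF _ measurable_ennreal] measurable_completion) simp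
  have [measurable]: "(\<lambda>t. indicator {a<..<b} t * f t) \<in> borel_measurable lebesgue"
    using assms(5) by (simp add: set_borel_measurable_def)
  have h[measurable]: "h \<in> borel_measurable lebesgue"
    unfolding h_def by measurable
  have F_nonneg: "F x \<ge> 0" if "x \<in> {a<..<b}" for x
    unfolding F_def set_lebesgue_integral_def using that f_nonneg
    by (intro Bochner_Integration.integral_nonneg) (auto simp: indicator_def)
  have R_nonneg: "R_int r t b \<ge> 0" if "t \<in> {a<..<b}" for t
    unfolding R_int_def set_lebesgue_integral_def using that r_pos
    by (intro Bochner_Integration.integral_nonneg) (auto simp: indicator_def less_imp_le)
  have jensen: "ennreal (F x ^ Suc p) \<le> ennreal ((b - a) ^ p) * (\<integral>\<^sup>+t\<in>{a<..<x}. h t \<partial>lebesgue)"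
    if x: "x \<in> {a<..<b}" for x
  proof -
    have "ennreal (F x ^ Suc p) \<le> ennreal ((x - a) ^ p)
        * (\<integral>\<^sup>+t\<in>{a<..<x}. ennreal (f t ^ Suc p) \<partial>lebesgue)"
      using set_integral_power_le_nn_integral[of "{a<..<x}" lebesgue f p] assms(8)[OF x] x f_nonneg
      by (auto simp: F_def)
    also have "(\<integral>\<^sup>+t\<in>{a<..<x}. ennreal (f t ^ Suc p) \<partial>lebesgue)
        = (\<integral>\<^sup>+t\<in>{a<..<x}. h t \<partial>lebesgue)"
      using x by (intro nn_integral_cong) (auto simp: h_def indicator_def)
    also have "ennreal ((x - a) ^ p) \<le> ennreal ((b - a) ^ p)"
      using x by (auto intro!: ennreal_leI power_mono)
    finally show ?thesis
      by (simp add: mult_right_mono)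
  qed
  have R: "(\<integral>\<^sup>+x\<in>{t<..<b}. g x \<partial>lebesgue) = ennreal (R_int r t b)" if t: "t \<in> {a<..<b}" for t
  proof -
    have "ennreal (R_int r t b) = (\<integral>\<^sup>+x\<in>{t<..<b}. ennreal (r x) \<partial>lebesgue)"
      unfolding R_int_def using assms(7)[OF t] t r_pos
      by (intro ennreal_set_integral) (auto simp: less_imp_le)
    also have "\<dots> = (\<integral>\<^sup>+x\<in>{t<..<b}. g x \<partial>lebesgue)"
      using t by (intro nn_integral_cong) (auto simp: g_def indicator_def)
    finally show ?thesis ..
  qed
  \<comment> \<open>The chain runs in \<open>ennreal\<close>. Integrability of the two outer
    integrands converts its first and last terms between real and nonnegative integrals.\<close>
  have "ennreal (LINT x:{a<..<b}|lebesgue. r x * F x ^ Suc p)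
      = (\<integral>\<^sup>+x\<in>{a<..<b}. ennreal (r x * F x ^ Suc p) \<partial>lebesgue)"
    using assms(9) r_pos F_nonneg
    by (intro ennreal_set_integral) (auto simp: F_def less_imp_le)
  also have "\<dots> \<le> (\<integral>\<^sup>+x. ennreal ((b - a) ^ p)
      * (g x * (\<integral>\<^sup>+t\<in>{a<..<x}. h t \<partial>lebesgue) * indicator {a<..<b} x) \<partial>lebesgue)"
  proof (rule nn_integral_mono)
    fix x
    have "ennreal (r x * F x ^ Suc p)
        \<le> ennreal ((b - a) ^ p) * (g x * (\<integral>\<^sup>+t\<in>{a<..<x}. h t \<partial>lebesgue))"
      if x: "x \<in> {a<..<b}"
      using mult_left_mono[OF jensen[OF x], of "ennreal (r x)"] x r_pos[OF x] F_nonneg[OF x]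
      by (simp add: g_def ennreal_mult mult_ac del: power_Suc)
    then show "ennreal (r x * F x ^ Suc p) * indicator {a<..<b} x
        \<le> ennreal ((b - a) ^ p) * (g x * (\<integral>\<^sup>+t\<in>{a<..<x}. h t \<partial>lebesgue) * indicator {a<..<b} x)"
      by (auto simp: indicator_def simp del: power_Suc)
  qed
  also have "\<dots> = ennreal ((b - a) ^ p)
      * (\<integral>\<^sup>+x\<in>{a<..<b}. g x * (\<integral>\<^sup>+t\<in>{a<..<x}. h t \<partial>lebesgue) \<partial>lebesgue)"
  proof (rule nn_integral_cmult)
    \<comment> \<open>The domain of the inner integral depends on \<open>x\<close>. Moving the
      condition t < x into the integrand gives a jointly measurable function, whose integral over
      \<open>t\<close> is measurable in \<open>x\<close>.\<close>
    interpret pair_sigma_finite lebesgue "lebesgue :: real measure" ..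
    have [measurable]: "(\<lambda>x. x) \<in> borel_measurable lebesgue"
      by (rule measurable_completion) simp
    have "(\<lambda>x. g x * (\<integral>\<^sup>+t. (if a < t \<and> t < x then h t else 0) \<partial>lebesgue)
        * (if a < x \<and> x < b then 1 else 0)) \<in> borel_measurable lebesgue"
      by measurable
    then show "(\<lambda>x. g x * (\<integral>\<^sup>+t\<in>{a<..<x}. h t \<partial>lebesgue) * indicator {a<..<b} x)
        \<in> borel_measurable lebesgue"
      by (simp add: indicator_def if_distrib cong: if_cong)
  qed
  also have "(\<integral>\<^sup>+x\<in>{a<..<b}. g x * (\<integral>\<^sup>+t\<in>{a<..<x}. h t \<partial>lebesgue) \<partial>lebesgue)
      = (\<integral>\<^sup>+t\<in>{a<..<b}. (\<integral>\<^sup>+x\<in>{t<..<b}. g x \<partial>lebesgue) * h t \<partial>lebesgue)"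
    by (rule nn_integral_triangle_swap) measurable
  also have "\<dots> = (\<integral>\<^sup>+t\<in>{a<..<b}. ennreal (R_int r t b * f t ^ Suc p) \<partial>lebesgue)"
    using f_nonneg R_nonneg
    by (intro nn_integral_cong) (auto simp: R h_def ennreal_mult split: split_indicator simp del: power_Suc)
  also have "\<dots> = ennreal (LINT t:{a<..<b}|lebesgue. R_int r t b * f t ^ Suc p)"
    using assms(10) f_nonneg R_nonneg
    by (intro ennreal_set_integral[symmetric]) auto
  finally have "ennreal (LINT x:{a<..<b}|lebesgue. r x * F x ^ Suc p)
      \<le> ennreal ((b - a) ^ p * (LINT t:{a<..<b}|lebesgue. R_int r t b * f t ^ Suc p))"
    using \<open>a < b\<close> by (simp add: ennreal_mult' del: power_Suc)
  \<comment> \<open>\<open>ennreal\<close> sends negative reals to 0, so the return to the reals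
    requires a nonnegative right side.\<close>
  moreover have "0 \<le> (LINT t:{a<..<b}|lebesgue. R_int r t b * f t ^ Suc p)"
    unfolding set_lebesgue_integral_def using f_nonneg R_nonneg
    by (intro Bochner_Integration.integral_nonneg) (auto simp: indicator_def)
  ultimately show ?thesis
    using \<open>a < b\<close> by (simp add: F_def)
qed

end
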